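(* Let $Q\in\mathbb{R}^{m\times n}$ have orthonormal columns, $m>n$, and define $P_Q=QQ^T$ and $P_Q^\perp=I-QQ^T$. Let $X\in\operatorname{range}(P_Q^\perp)$ be a fixed vector, let $\sigma>0$, and let $Y\sim N(0,\sigma^2I_m)$. Define $$\widehat r=\frac{P_Q^\perp(X+Y)}{\sqrt{\|P_Q^\perp(X+Y)\|_2^2+\|P_QY\|_2^2}}.$$ Then, for every $0<\tau<1$, $$\mathbb P(\|\widehat r\|_2\ge\tau)=1-F'_{m-n,n}\left(\frac{n\tau^2}{(m-n)(1-\tau^2)};\frac{\|X\|_2^2}{\sigma^2}\right).$$
   Context: $N(0,\sigma^2I_m)$ is the centered Gaussian distribution on $\mathbb{R}^m$ with covariance $\sigma^2I_m$. $F'_{d_1,d_2}(\cdot;\lambda)$ is the CDF of the noncentral $F$-distribution with numerator degrees of freedom $d_1$, denominator degrees of freedom $d_2$, and numerator noncentrality parameter $\lambda$, i.e. the distribution of $\frac{U/d_1}{V/d_2}$ with $U,V$ independent, $U$ noncentral chi-square with $d_1$ degrees of freedom and noncentrality $\lambda$ (the law of $\|\mu+Z\|_2^2$ with $Z\sim N(0,I_{d_1})$, $\|\mu\|_2^2=\lambda$), and $V$ (central) chi-square with $d_2$ degrees of freedom. The denominator of $\widehat r$ is nonzero almost surely. *)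

theory Defs
  imports "HOL-Probability.Probability"
begin

section \<open>Gaussian vectors\<close>

text \<open>Lebesgue density of \<open>N(\<mu>, \<Sigma>)\<close>; meaningful for positive definite \<open>\<Sigma>\<close> only.\<close>

definition gaussian_density :: "real ^ 'm \<Rightarrow> real ^ 'm ^ 'm \<Rightarrow> real ^ 'm \<Rightarrow> real" where
  "gaussian_density \<mu> \<Sigma> y =
     exp (- ((y - \<mu>) \<bullet> (matrix_inv \<Sigma> *v (y - \<mu>))) / 2) / sqrt ((2 * pi) ^ CARD('m) * det \<Sigma>)"

section \<open>Noncentral chi-square and noncentral F distributions\<close>

text \<open>
  The degrees of freedom are natural numbers computed from other dimensions, so a vector of
  \<open>\<real>\<^sup>d\<close> is here a function on \<open>{..<d}\<close>, and \<open>N(0, I\<^sub>d)\<close> is the \<open>d\<close>-fold product of the standard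
  normal distribution.  \<open>sq_norm_law d \<mu>\<close> is the law of \<open>\<parallel>\<mu> + Z\<parallel>\<^sup>2\<close> for \<open>Z \<sim> N(0, I\<^sub>d)\<close>.
\<close>

definition std_gaussian :: "nat \<Rightarrow> (nat \<Rightarrow> real) measure" where
  "std_gaussian d = (\<Pi>\<^sub>M i\<in>{..<d}. density lborel (\<lambda>x. ennreal (std_normal_density x)))"

definition sq_norm_law :: "nat \<Rightarrow> (nat \<Rightarrow> real) \<Rightarrow> real measure" where
  "sq_norm_law d \<mu> = distr (std_gaussian d) borel (\<lambda>z. \<Sum>i<d. (\<mu> i + z i)\<^sup>2)"

definition chi_square :: "nat \<Rightarrow> real measure" where
  "chi_square d = sq_norm_law d (\<lambda>_. 0)"

text \<open>
  By rotation invariance of \<open>N(0, I\<^sub>d)\<close>, the law of \<open>\<parallel>\<mu> + Z\<parallel>\<^sup>2\<close> depends on \<open>\<mu>\<close> only through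
  \<open>\<parallel>\<mu>\<parallel>\<^sup>2\<close>, so the choice of \<open>\<mu>\<close> below is immaterial.  A suitable \<open>\<mu>\<close> exists whenever
  \<open>d \<ge> 1\<close> and \<open>\<delta> \<ge> 0\<close>.
\<close>

definition noncentral_chi_square :: "nat \<Rightarrow> real \<Rightarrow> real measure" where
  "noncentral_chi_square d \<delta> = sq_norm_law d (SOME \<mu>. (\<Sum>i<d. (\<mu> i)\<^sup>2) = \<delta>)"

definition noncentral_F :: "nat \<Rightarrow> nat \<Rightarrow> real \<Rightarrow> real measure" where
  "noncentral_F d1 d2 \<delta> =
     distr (noncentral_chi_square d1 \<delta> \<Otimes>\<^sub>M chi_square d2) borel
       (\<lambda>(u, v). (u / real d1) / (v / real d2))"

section \<open>Projections and the normalized residual\<close>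

definition orthonormal_columns :: "real ^ 'n ^ 'm \<Rightarrow> bool" where
  "orthonormal_columns Q \<longleftrightarrow>
     (\<forall>i j. column i Q \<bullet> column j Q = (if i = j then 1 else 0))"

definition proj :: "real ^ 'n ^ 'm \<Rightarrow> real ^ 'm ^ 'm" where
  "proj Q = Q ** transpose Q"

definition proj_perp :: "real ^ 'n ^ 'm \<Rightarrow> real ^ 'm ^ 'm" where
  "proj_perp Q = mat 1 - Q ** transpose Q"

text \<open>Where the denominator vanishes (almost nowhere in \<open>y\<close>), the value is \<open>0\<close>.\<close>

definition r_hat :: "real ^ 'n ^ 'm \<Rightarrow> real ^ 'm \<Rightarrow> real ^ 'm \<Rightarrow> real ^ 'm" where
  "r_hat Q X y =
     (proj_perp Q *v (X + y)) /\<^sub>R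
       sqrt ((norm (proj_perp Q *v (X + y)))\<^sup>2 + (norm (proj Q *v y))\<^sup>2)"

end

theory Submission imports Defs begin

text \<open>
  Extend the columns of \<open>Q\<close> to an orthonormal basis of the whole space.  A Householder
  reflection inside the orthogonal complement of the columns lets us prescribe the coordinates of
  \<open>X / \<sigma>\<close>, and we choose them equal to the vector \<open>\<mu>\<close> that was picked in the definition of the
  noncentral chi-square law; so the rotation invariance of \<open>sq_norm_law\<close> itself is never needed.
  In these coordinates \<open>Y / \<sigma>\<close> is standard Gaussian, whence \<open>U = \<parallel>P\<^sub>Q\<^sup>\<bottom>(X + Y)\<parallel>\<^sup>2 / \<sigma>\<^sup>2\<close> and
  \<open>V = \<parallel>P\<^sub>Q Y\<parallel>\<^sup>2 / \<sigma>\<^sup>2\<close> are functions of disjoint blocks of independent coordinates, with a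
  noncentral and a central chi-square law.  The event is \<open>U (1 - \<tau>\<^sup>2) \<ge> \<tau>\<^sup>2 V\<close>; replacing \<open>\<ge>\<close>
  by \<open>>\<close> costs nothing because chi-square laws have no atoms.
\<close>

section \<open>Rotation invariance of Lebesgue measure\<close>

lemma nn_integral_lborel_translation:
  fixes f :: "'a::euclidean_space \<Rightarrow> ennreal"
  assumes [measurable]: "f \<in> borel_measurable borel"
  shows "(\<integral>\<^sup>+x. f (x + c) \<partial>lborel) = (\<integral>\<^sup>+x. f x \<partial>lborel)"
proof -
  have "(\<integral>\<^sup>+x. f x \<partial>lborel) = (\<integral>\<^sup>+x. f x \<partial>distr lborel borel ((+) c))"
    by (simp only: lborel_distr_plus)
  also have "\<dots> = (\<integral>\<^sup>+x. f (c + x) \<partial>lborel)"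
    by (subst nn_integral_distr) auto
  finally show ?thesis
    by (simp only: add.commute)
qed

text \<open>
  The uniqueness argument for Haar measure: integrating \<open>1\<^sub>A(T x) 1\<^sub>B(y)\<close> over both variables, with
  \<open>B\<close> the unit ball, and shifting first \<open>y\<close> by \<open>- T x\<close> and then \<open>x\<close> by the \<open>T\<close>-preimage of \<open>y\<close>.
\<close>

lemma distr_lborel_orthogonal:
  fixes T :: "'a::euclidean_space \<Rightarrow> 'a"
  assumes T: "orthogonal_transformation T"
  shows "distr lborel borel T = lborel"
proof (rule measure_eqI)
  show "sets (distr lborel borel T) = sets lborel" by simp
  have lin: "linear T"
    using T by (simp add: orthogonal_transformation_linear)
  have [measurable]: "T \<in> borel_measurable borel"
    using lin by (intro borel_measurable_continuous_onI linear_continuous_on linear_conv_bounded_linear[THEN iffD1])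
  fix A :: "'a set"
  assume "A \<in> sets (distr lborel borel T)"
  then have [measurable]: "A \<in> sets borel" by simp
  define a :: "'a \<Rightarrow> ennreal" where "a = indicator A"
  define b :: "'a \<Rightarrow> ennreal" where "b = indicator (ball 0 1)"
  have [measurable]: "a \<in> borel_measurable borel" "b \<in> borel_measurable borel"
    by (simp_all add: a_def b_def borel_measurable_indicator)
  \<comment> \<open>The unit ball is invariant under negation and under the isometry
    \<open>T\<close>.\<close>
  have b_T: "b (- T x) = b x" for x
    using orthogonal_transformation_norm[OF T] by (simp add: b_def indicator_def)
  have shift: "(\<integral>\<^sup>+x. a (T x) * b (y - T x) \<partial>lborel) = (\<integral>\<^sup>+x. a (T x + y) * b x \<partial>lborel)" for y
  proof -
    obtain z where z: "T z = y"
      using orthogonal_transformation_surj[OF T] by (metis surjD)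
    have "(\<integral>\<^sup>+x. a (T x) * b (y - T x) \<partial>lborel) = (\<integral>\<^sup>+x. a (T (x + z)) * b (y - T (x + z)) \<partial>lborel)"
      by (subst nn_integral_lborel_translation) auto
    then show ?thesis
      by (simp add: linear_add[OF lin] z b_T)
  qed
  have "(\<integral>\<^sup>+x. a (T x) \<partial>lborel) * (\<integral>\<^sup>+y. b y \<partial>lborel) = (\<integral>\<^sup>+x. (\<integral>\<^sup>+y. a (T x) * b y \<partial>lborel) \<partial>lborel)"
    by (simp add: nn_integral_cmult nn_integral_multc)
  also have "\<dots> = (\<integral>\<^sup>+x. (\<integral>\<^sup>+y. a (T x) * b (y - T x) \<partial>lborel) \<partial>lborel)"
  proof (rule nn_integral_cong)
    fix x :: 'a
    show "(\<integral>\<^sup>+y. a (T x) * b y \<partial>lborel) = (\<integral>\<^sup>+y. a (T x) * b (y - T x) \<partial>lborel)"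
      using nn_integral_lborel_translation[of "\<lambda>y. a (T x) * b y" "- T x"] by simp
  qed
  also have "\<dots> = (\<integral>\<^sup>+y. (\<integral>\<^sup>+x. a (T x) * b (y - T x) \<partial>lborel) \<partial>lborel)"
    by (rule lborel_pair.Fubini') simp
  also have "\<dots> = (\<integral>\<^sup>+y. (\<integral>\<^sup>+x. a (T x + y) * b x \<partial>lborel) \<partial>lborel)"
    by (simp add: shift)
  also have "\<dots> = (\<integral>\<^sup>+x. (\<integral>\<^sup>+y. a (T x + y) * b x \<partial>lborel) \<partial>lborel)"
    by (rule lborel_pair.Fubini'[symmetric]) simp
  also have "\<dots> = (\<integral>\<^sup>+x. (\<integral>\<^sup>+y. a y * b x \<partial>lborel) \<partial>lborel)"
  proof (rule nn_integral_cong)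
    fix x :: 'a
    show "(\<integral>\<^sup>+y. a (T x + y) * b x \<partial>lborel) = (\<integral>\<^sup>+y. a y * b x \<partial>lborel)"
      using nn_integral_lborel_translation[of "\<lambda>y. a y * b x" "T x"] by (simp add: add.commute)
  qed
  also have "\<dots> = (\<integral>\<^sup>+y. a y \<partial>lborel) * (\<integral>\<^sup>+x. b x \<partial>lborel)"
    by (simp add: nn_integral_cmult nn_integral_multc)
  finally have "emeasure lborel (T -` A) * emeasure lborel (ball (0 :: 'a) 1) = emeasure lborel A * emeasure lborel (ball (0 :: 'a) 1)"
    using measurable_sets[of T borel borel A]
    by (simp add: a_def b_def indicator_vimage[symmetric])
  moreover have "emeasure lborel (ball (0 :: 'a) 1) = ennreal (unit_ball_vol (real DIM('a)))"
    using emeasure_ball[of 1 "0 :: 'a"] by simp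
  moreover have "unit_ball_vol (real DIM('a)) > 0"
    by simp
  \<comment> \<open>The unit ball has finite and positive volume, so its factor cancels in
    \<open>ennreal\<close>.\<close>
  ultimately have "emeasure lborel (T -` A) = emeasure lborel A"
    by (simp only: mult_right_ennreal_cancel) linarith
  then show "emeasure (distr lborel borel T) A = emeasure lborel A"
    by (simp add: emeasure_distr)
qed

section \<open>Standard Gaussian vectors\<close>

text \<open>Tonelli for products of coordinate functions, carried over from the version indexed by
  \<open>Basis\<close> along the bijection sending \<open>k\<close> to
  \<open>axis k 1\<close>.\<close>

lemma nn_integral_lborel_prod_vec:
  fixes f :: "'m::finite \<Rightarrow> real \<Rightarrow> ennreal"
  assumes [measurable]: "\<And>k. f k \<in> borel_measurable borel"
  shows "(\<integral>\<^sup>+y. (\<Prod>k\<in>UNIV. f k (y $ k)) \<partial>(lborel :: (real ^ 'm) measure)) = (\<Prod>k\<in>UNIV. \<integral>\<^sup>+x. f k x \<partial>lborel)"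
proof -
  define e :: "'m \<Rightarrow> real ^ 'm" where "e k = axis k 1" for k
  have bij: "bij_betw e UNIV Basis"
    by (auto simp: e_def bij_betw_def inj_on_def axis_eq_axis Basis_vec_def)
  have inv: "the_inv_into UNIV e (e k) = k" for k
    using bij by (intro the_inv_into_f_f) (auto simp: bij_betw_def)
  define f' where "f' b = f (the_inv_into UNIV e b)" for b
  have [measurable]: "f' b \<in> borel_measurable borel" for b
    by (simp add: f'_def)
  have "(\<integral>\<^sup>+y. (\<Prod>b\<in>Basis. f' b (y \<bullet> b)) \<partial>(lborel :: (real ^ 'm) measure)) = (\<Prod>b\<in>Basis. \<integral>\<^sup>+x. f' b x \<partial>lborel)"
    by (rule nn_integral_lborel_prod) auto
  moreover have "(\<Prod>b\<in>Basis. f' b (y \<bullet> b)) = (\<Prod>k\<in>UNIV. f k (y $ k))" for y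
    by (subst prod.reindex_bij_betw[OF bij, symmetric])
       (simp add: f'_def inv, simp add: e_def inner_axis)
  moreover have "(\<Prod>b\<in>Basis. \<integral>\<^sup>+x. f' b x \<partial>lborel) = (\<Prod>k\<in>UNIV. \<integral>\<^sup>+x. f k x \<partial>lborel)"
    by (subst prod.reindex_bij_betw[OF bij, symmetric]) (simp add: f'_def inv)
  ultimately show ?thesis by simp
qed

text \<open>The density of N(0, I). The product form exposes independence of the coordinates;
  rotation invariance is read off from the norm form proved below.\<close>

definition std_normal_density_vec :: "real ^ 'm \<Rightarrow> real" where
  "std_normal_density_vec y = (\<Prod>k\<in>UNIV. std_normal_density (y $ k))"

lemma borel_measurable_std_normal_density_vec [measurable]:
  "std_normal_density_vec \<in> borel_measurable borel"
  unfolding std_normal_density_vec_def by measurable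

lemma std_normal_density_vec_norm:
  "std_normal_density_vec (y :: real ^ 'm) = exp (- (norm y)\<^sup>2 / 2) / sqrt (2 * pi) ^ CARD('m)"
proof -
  have "std_normal_density_vec y = (\<Prod>k\<in>(UNIV :: 'm set). 1 / sqrt (2 * pi)) * exp (\<Sum>k\<in>UNIV. - (y $ k)\<^sup>2 / 2)"
    unfolding std_normal_density_vec_def std_normal_density_def by (simp only: prod.distrib exp_sum finite)
  also have "(\<Sum>k\<in>UNIV. - (y $ k)\<^sup>2 / 2) = - (norm y)\<^sup>2 / 2"
    by (simp only: norm_vec_def L2_set_def real_norm_def power2_abs real_sqrt_pow2 sum_nonneg zero_le_power2
        sum_negf[symmetric] sum_divide_distrib)
  finally show ?thesis
    by (simp add: power_divide)
qed

section \<open>The Gaussian density with covariance \<open>\<sigma>\<^sup>2\<close> times the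
  identity\<close>

lemma matrix_inv_mat:
  fixes c :: real
  assumes "c \<noteq> 0"
  shows "matrix_inv (mat c :: real ^ 'm ^ 'm) = mat (1 / c)"
proof -
  have 1: "(mat a :: real ^ 'm ^ 'm) ** mat b = mat (a * b)" for a b :: real
    by (simp add: matrix_matrix_mult_def mat_def vec_eq_iff mult_delta_left)
  show ?thesis
    unfolding matrix_inv_def
  proof (rule some_equality)
    show "mat c ** mat (1 / c) = (mat 1 :: real ^ 'm ^ 'm) \<and> mat (1 / c) ** mat c = (mat 1 :: real ^ 'm ^ 'm)"
      using assms by (simp add: 1)
    \<comment> \<open>\<open>matrix_inv\<close> is a choice among two-sided inverses, so uniqueness
      has to be shown as well.\<close>
    fix B :: "real ^ 'm ^ 'm"
    assume B: "mat c ** B = mat 1 \<and> B ** mat c = mat 1"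
    have "B = (mat (1 / c) ** mat c) ** B"
      using assms by (simp add: 1)
    also have "\<dots> = mat (1 / c)"
      by (simp only: matrix_mul_assoc[symmetric] B matrix_mul_rid)
    finally show "B = mat (1 / c)" .
  qed
qed

lemma gaussian_density_mat:
  fixes y :: "real ^ 'm"
  assumes "\<sigma> > 0"
  shows "gaussian_density 0 (mat (\<sigma>\<^sup>2)) y = std_normal_density_vec (y /\<^sub>R \<sigma>) / \<sigma> ^ CARD('m)"
proof -
  have mv: "mat c *v v = c *\<^sub>R v" for c :: real and v :: "real ^ 'm"
    by (simp add: matrix_vector_mult_def mat_def vec_eq_iff mult_delta_left)
  have det_mat: "det (mat (\<sigma>\<^sup>2) :: real ^ 'm ^ 'm) = (\<sigma> ^ CARD('m))\<^sup>2"
    by (subst det_diagonal) (simp_all add: mat_def power_mult[symmetric] mult.commute)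
  have det: "sqrt ((2 * pi) ^ CARD('m) * det (mat (\<sigma>\<^sup>2) :: real ^ 'm ^ 'm)) = sqrt (2 * pi) ^ CARD('m) * \<sigma> ^ CARD('m)"
  proof (intro real_sqrt_unique)
    have "(sqrt (2 * pi) ^ CARD('m))\<^sup>2 = ((sqrt (2 * pi))\<^sup>2) ^ CARD('m)"
      by (simp only: power_mult[symmetric] mult.commute)
    then show "(sqrt (2 * pi) ^ CARD('m) * \<sigma> ^ CARD('m))\<^sup>2 = (2 * pi) ^ CARD('m) * det (mat (\<sigma>\<^sup>2) :: real ^ 'm ^ 'm)"
      by (simp add: det_mat power_mult_distrib)
  qed (use assms in simp)
  have "y \<bullet> (matrix_inv (mat (\<sigma>\<^sup>2)) *v y) = (norm (y /\<^sub>R \<sigma>))\<^sup>2"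
    using assms by (simp add: matrix_inv_mat mv power_mult_distrib power2_norm_eq_inner power_divide divide_inverse power_inverse)
  then show ?thesis
    unfolding gaussian_density_def std_normal_density_vec_norm det by simp
qed

text \<open>Links the two encodings of N(0, I): a Lebesgue density on \<open>real ^ 'm\<close>, and
  a product measure on functions on \<open>{..<d}\<close>. The enumeration \<open>h\<close> orders
  the coordinates. A product measure is determined by its values on boxes, and on a box the integral
  of the density factors by Tonelli.\<close>

lemma std_gaussian_eq_distr_vec:
  fixes h :: "nat \<Rightarrow> 'm::finite"
  assumes "bij_betw h {..<d} UNIV"
  shows "distr (density lborel (\<lambda>y :: real ^ 'm. ennreal (std_normal_density_vec y)))
           (\<Pi>\<^sub>M i\<in>{..<d}. borel) (\<lambda>y. \<lambda>i\<in>{..<d}. y $ h i) = std_gaussian d"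
proof -
  let ?N = "density lborel (\<lambda>x. ennreal (std_normal_density x))"
  interpret prob_space ?N
    by (rule prob_space_normal_density) simp
  interpret product_sigma_finite "\<lambda>_::nat. ?N"
    by standard
  let ?D = "density lborel (\<lambda>y :: real ^ 'm. ennreal (std_normal_density_vec y))"
  let ?f = "\<lambda>y :: real ^ 'm. \<lambda>i\<in>{..<d}. y $ h i"
  define g where "g = the_inv_into {..<d} h"
  have gh: "g (h i) = i" if "i < d" for i
    using assms that unfolding g_def bij_betw_def by (intro the_inv_into_f_f) auto
  have bij: "bij_betw g UNIV {..<d}"
    using assms unfolding g_def by (rule bij_betw_the_inv_into)
  have hg: "h (g k) = k" for k
    using assms unfolding g_def bij_betw_def by (intro f_the_inv_into_f) auto
  have [measurable]: "?f \<in> borel \<rightarrow>\<^sub>M (\<Pi>\<^sub>M i\<in>{..<d}. borel)"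
    by measurable
  show ?thesis
    unfolding std_gaussian_def
  proof (rule PiM_eqI)
    show "sets (distr ?D (\<Pi>\<^sub>M i\<in>{..<d}. borel) ?f) = sets (Pi\<^sub>M {..<d} (\<lambda>_. ?N))"
      by (simp cong: sets_PiM_cong)
    fix A :: "nat \<Rightarrow> real set"
    assume "\<And>i. i \<in> {..<d} \<Longrightarrow> A i \<in> sets ?N"
    then have A: "A i \<in> sets borel" if "i < d" for i
      using that by simp
    have gd: "g k < d" for k
      using bij by (auto simp: bij_betw_def)
    have Ag[measurable]: "A (g k) \<in> sets borel" for k
      using A gd by blast
    have PA: "Pi\<^sub>E {..<d} A \<in> sets (\<Pi>\<^sub>M i\<in>{..<d}. borel)"
      using A by (intro sets_PiM_I_finite) auto
    have ev: "?f y \<in> Pi\<^sub>E {..<d} A \<longleftrightarrow> (\<forall>k. y $ k \<in> A (g k))" for y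
    proof -
      have "?f y \<in> Pi\<^sub>E {..<d} A \<longleftrightarrow> (\<forall>i<d. y $ h i \<in> A i)"
        by (auto simp: PiE_iff)
      also have "\<dots> \<longleftrightarrow> (\<forall>k. y $ k \<in> A (g k))"
        by (metis gd gh hg)
      finally show ?thesis .
    qed
    have "emeasure (distr ?D (\<Pi>\<^sub>M i\<in>{..<d}. borel) ?f) (Pi\<^sub>E {..<d} A) = emeasure ?D (?f -` Pi\<^sub>E {..<d} A)"
      using PA by (subst emeasure_distr) auto
    also have "\<dots> = (\<integral>\<^sup>+y. ennreal (std_normal_density_vec y) * indicator (?f -` Pi\<^sub>E {..<d} A) y \<partial>lborel)"
      using measurable_sets[of ?f borel "\<Pi>\<^sub>M i\<in>{..<d}. borel" "Pi\<^sub>E {..<d} A"] PA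
      by (subst emeasure_density) auto
    \<comment> \<open>The indicator of a box is the product of the indicators of its sides, so the
      whole integrand is a product over coordinates.\<close>
    also have "\<dots> = (\<integral>\<^sup>+y. (\<Prod>k\<in>UNIV. ennreal (std_normal_density (y $ k)) * indicator (A (g k)) (y $ k)) \<partial>lborel)"
    proof (intro nn_integral_cong)
      fix y :: "real ^ 'm"
      have "indicator (?f -` Pi\<^sub>E {..<d} A) y = (\<Prod>k\<in>UNIV. indicator (A (g k)) (y $ k) :: ennreal)"
        unfolding indicator_def vimage_eq ev by (auto simp: prod_zero_iff)
      then show "ennreal (std_normal_density_vec y) * indicator (?f -` Pi\<^sub>E {..<d} A) y =
          (\<Prod>k\<in>UNIV. ennreal (std_normal_density (y $ k)) * indicator (A (g k)) (y $ k))"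
        by (simp add: std_normal_density_vec_def prod.distrib prod_ennreal)
    qed
    also have "\<dots> = (\<Prod>k\<in>UNIV. \<integral>\<^sup>+x. ennreal (std_normal_density x) * indicator (A (g k)) x \<partial>lborel)"
      by (rule nn_integral_lborel_prod_vec) measurable
    also have "\<dots> = (\<Prod>k\<in>UNIV. emeasure ?N (A (g k)))"
      by (intro prod.cong refl, subst emeasure_density) auto
    also have "\<dots> = (\<Prod>i<d. emeasure ?N (A i))"
      by (rule prod.reindex_bij_betw[OF bij])
    finally show "emeasure (distr ?D (\<Pi>\<^sub>M i\<in>{..<d}. borel) ?f) (Pi\<^sub>E {..<d} A) = (\<Prod>i<d. emeasure ?N (A i))" .
  qed simp
qed

text \<open>Division by \<sigma> standardizes \<open>Y\<close>; the orthogonal map then preserves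
  both Lebesgue measure and the density, which depends on the norm alone.\<close>

lemma distr_orthogonal_gaussian:
  fixes Y :: "'a \<Rightarrow> real ^ 'm" and T :: "real ^ 'm \<Rightarrow> real ^ 'm"
  assumes "\<sigma> > 0" and Y: "distributed M lborel Y (\<lambda>y. ennreal (gaussian_density 0 (mat (\<sigma>\<^sup>2)) y))"
    and T: "orthogonal_transformation T"
  shows "distr M borel (\<lambda>\<omega>. T (Y \<omega> /\<^sub>R \<sigma>)) = density lborel (\<lambda>y. ennreal (std_normal_density_vec y))"
proof -
  let ?g = "\<lambda>y :: real ^ 'm. gaussian_density 0 (mat (\<sigma>\<^sup>2)) y"
  let ?D = "density lborel (\<lambda>y :: real ^ 'm. ennreal (std_normal_density_vec y))"
  have [simp]: "\<sigma> \<noteq> 0"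
    using assms(1) by simp
  have [measurable]: "Y \<in> M \<rightarrow>\<^sub>M borel"
    using distributed_measurable[OF Y] by simp
  have [measurable]: "?g \<in> borel_measurable borel"
    unfolding gaussian_density_mat[OF assms(1)] by measurable
  have [measurable]: "T \<in> borel_measurable borel"
    using T by (intro borel_measurable_continuous_onI linear_continuous_on linear_conv_bounded_linear[THEN iffD1]
        orthogonal_transformation_linear)
  have "distr M borel Y = density lborel (\<lambda>y. ennreal (?g y))"
    using distributed_distr_eq_density[OF Y] by (metis distr_cong sets_lborel)
  \<comment> \<open>Lebesgue measure is rewritten as its own image under scaling by \<sigma>; the
    Jacobian \<open>\<sigma> ^ CARD('m)\<close> cancels the normalizing factor of the Gaussian
    density.\<close>
  also have "\<dots> = density (density (distr lborel borel (\<lambda>y. \<sigma> *\<^sub>R y)) (\<lambda>_. \<sigma> ^ CARD('m))) (\<lambda>y. ennreal (?g y))"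
    using lborel_affine[of \<sigma> "0 :: real ^ 'm"] assms(1) by simp
  also have "\<dots> = density (distr lborel borel (\<lambda>y. \<sigma> *\<^sub>R y)) (\<lambda>y. ennreal (\<sigma> ^ CARD('m) * ?g y))"
    using assms(1) by (subst density_density_eq) (auto simp: ennreal_mult')
  also have "\<dots> = distr ?D borel (\<lambda>y. \<sigma> *\<^sub>R y)"
    by (subst density_distr) (auto simp: gaussian_density_mat assms(1) ennreal_mult')
  finally have law: "distr M borel Y = distr ?D borel (\<lambda>y. \<sigma> *\<^sub>R y)" .
  have "distr M borel (\<lambda>\<omega>. T (Y \<omega> /\<^sub>R \<sigma>)) = distr (distr M borel Y) borel (\<lambda>y. T (y /\<^sub>R \<sigma>))"
    by (subst distr_distr) (auto simp: comp_def)
  also have "\<dots> = distr ?D borel T"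
    unfolding law using assms(1) by (subst distr_distr) (auto simp: comp_def)
  \<comment> \<open>Inserting \<open>T\<close> inside the density is free since \<open>T\<close>
    preserves norms; the density is now a function of \<open>T y\<close> and can be moved outside
    the image measure.\<close>
  also have "\<dots> = distr (density lborel (\<lambda>y. ennreal (std_normal_density_vec (T y)))) borel T"
    using T by (simp add: std_normal_density_vec_norm orthogonal_transformation)
  also have "\<dots> = density (distr lborel borel T) (\<lambda>y. ennreal (std_normal_density_vec y))"
    by (subst density_distr) auto
  finally show ?thesis
    by (simp add: distr_lborel_orthogonal[OF T])
qed

section \<open>Laws of squared norms\<close>

text \<open>The index map \<open>f\<close> serves both the leading block of coordinates (identity)
  and the trailing block (a shift).\<close>

lemma measurable_shifted_sq_sum [measurable]:
  fixes N :: "'i \<Rightarrow> real measure"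
  assumes [measurable_cong]: "\<And>i. sets (N i) = sets borel" and "f ` A \<subseteq> I"
  shows "(\<lambda>z. \<Sum>i\<in>A. (\<mu> i + z (f i))\<^sup>2) \<in> borel_measurable (Pi\<^sub>M I N)"
proof (intro borel_measurable_sum borel_measurable_power borel_measurable_add borel_measurable_const)
  fix i assume "i \<in> A"
  then have "(\<lambda>z. z (f i)) \<in> Pi\<^sub>M I N \<rightarrow>\<^sub>M N (f i)"
    using assms(2) by (intro measurable_component_singleton) auto
  then show "(\<lambda>z. z (f i)) \<in> borel_measurable (Pi\<^sub>M I N)"
    by (simp add: assms(1) cong: measurable_cong_sets)
qed

lemma prob_space_std_normal: "prob_space (density lborel (\<lambda>x. ennreal (std_normal_density x)))"
  by (rule prob_space_normal_density) simp

lemma prob_space_std_gaussian: "prob_space (std_gaussian d)"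
  unfolding std_gaussian_def by (intro prob_space_PiM prob_space_std_normal)

lemma measurable_sq_norm_std_gaussian:
  assumes "f ` {..<a} \<subseteq> {..<d}"
  shows "(\<lambda>z. \<Sum>i<a. (\<mu> i + z (f i))\<^sup>2) \<in> borel_measurable (std_gaussian d)"
  unfolding std_gaussian_def using assms by (intro measurable_shifted_sq_sum) auto

lemma prob_space_sq_norm_law: "prob_space (sq_norm_law d \<mu>)"
  unfolding sq_norm_law_def
  using measurable_sq_norm_std_gaussian[of "\<lambda>i. i" d d \<mu>]
  by (intro prob_space.prob_space_distr prob_space_std_gaussian) simp

lemma sets_sq_norm_law [simp, measurable_cong]: "sets (sq_norm_law d \<mu>) = sets borel"
  by (simp add: sq_norm_law_def)

text \<open>The product measure over a disjoint union of index sets is the image under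
  \<open>merge\<close> of the pair of product measures. Each sum reads only its own block, so the
  joint law is a product.\<close>

lemma distr_std_gaussian_blocks:
  "distr (std_gaussian (a + b)) (borel \<Otimes>\<^sub>M borel)
     (\<lambda>z. (\<Sum>i<a. (\<mu> i + z i)\<^sup>2, \<Sum>i<b. (\<nu> i + z (a + i))\<^sup>2)) =
   sq_norm_law a \<mu> \<Otimes>\<^sub>M sq_norm_law b \<nu>"
proof -
  define N where "N = density lborel (\<lambda>x. ennreal (std_normal_density x))"
  interpret N: prob_space N
    unfolding N_def by (rule prob_space_std_normal)
  interpret product_sigma_finite "\<lambda>_::nat. N"
    by standard
  have std: "std_gaussian d = (\<Pi>\<^sub>M i\<in>{..<d}. N)" for d
    by (simp add: std_gaussian_def N_def)
  have sN: "sets N = sets borel"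
    by (simp add: N_def)
  let ?I = "{..<a}" and ?J = "{a..<a + b}"
  let ?u = "\<lambda>z. \<Sum>i<a. (\<mu> i + z i)\<^sup>2" and ?v = "\<lambda>z. \<Sum>i<b. (\<nu> i + z (a + i))\<^sup>2"
  have u: "?u \<in> borel_measurable (\<Pi>\<^sub>M i\<in>I. N)" if "?I \<subseteq> I" for I
    using measurable_shifted_sq_sum[of "\<lambda>_. N" "\<lambda>i. i" ?I I \<mu>] that sN by simp
  have v: "?v \<in> borel_measurable (\<Pi>\<^sub>M i\<in>I. N)" if "?J \<subseteq> I" for I
    using that by (intro measurable_shifted_sq_sum[OF sN]) auto
  have IJ: "{..<a + b} = ?I \<union> ?J"
    by auto
  have merge: "std_gaussian (a + b) = distr (Pi\<^sub>M ?I (\<lambda>_. N) \<Otimes>\<^sub>M Pi\<^sub>M ?J (\<lambda>_. N)) (Pi\<^sub>M (?I \<union> ?J) (\<lambda>_. N)) (merge ?I ?J)"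
    unfolding std IJ by (rule distr_merge[symmetric]) auto
  let ?r = "\<lambda>\<omega>. \<lambda>i\<in>{..<b}. \<omega> (a + i)"
  \<comment> \<open>The trailing block is renumbered from 0; all factors are equal, so the shift of
    indices preserves the law.\<close>
  have "std_gaussian b = distr (\<Pi>\<^sub>M i\<in>?J. N) (\<Pi>\<^sub>M i\<in>{..<b}. N) ?r"
    unfolding std using distr_PiM_reindex[of ?J "\<lambda>_. N" "\<lambda>i. a + i" "{..<b}"]
    by (auto simp: N.prob_space_axioms inj_on_def)
  then have sq_v: "sq_norm_law b \<nu> = distr (\<Pi>\<^sub>M i\<in>?J. N) borel ?v"
    unfolding sq_norm_law_def using measurable_sq_norm_std_gaussian[of "\<lambda>i. i" b b \<nu>]
    by (simp only:) (subst distr_distr, auto simp: std intro!: distr_cong sum.cong measurable_restrict measurable_component_singleton)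
  have sq_u: "sq_norm_law a \<mu> = distr (\<Pi>\<^sub>M i\<in>?I. N) borel ?u"
    by (simp add: sq_norm_law_def std)
  have "sq_norm_law a \<mu> \<Otimes>\<^sub>M sq_norm_law b \<nu> =
      distr (Pi\<^sub>M ?I (\<lambda>_. N) \<Otimes>\<^sub>M Pi\<^sub>M ?J (\<lambda>_. N)) (borel \<Otimes>\<^sub>M borel) (\<lambda>(x, y). (?u x, ?v y))"
    unfolding sq_u sq_v
  proof (rule pair_measure_distr)
    show "sigma_finite_measure (distr (\<Pi>\<^sub>M i\<in>?J. N) borel ?v)"
      using prob_space_sq_norm_law[of b \<nu>] unfolding sq_v by (rule prob_space_imp_sigma_finite)
  qed (use u v in auto)
  also have "\<dots> = distr (std_gaussian (a + b)) (borel \<Otimes>\<^sub>M borel) (\<lambda>z. (?u z, ?v z))"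
    unfolding merge
  proof (subst distr_distr[OF _ measurable_merge])
    show "(\<lambda>z. (?u z, ?v z)) \<in> Pi\<^sub>M (?I \<union> ?J) (\<lambda>_. N) \<rightarrow>\<^sub>M borel \<Otimes>\<^sub>M borel"
      using u[of "?I \<union> ?J"] v[of "?I \<union> ?J"] by (intro measurable_Pair) auto
  qed (auto simp: merge_def intro!: measurable_merge distr_cong sum.cong)
  finally show ?thesis ..
qed

section \<open>Absence of atoms and nonnegativity\<close>

lemma AE_std_normal_square_neq:
  "AE y in density lborel (\<lambda>x. ennreal (std_normal_density x)). c + (m + y)\<^sup>2 \<noteq> t"
proof -
  \<comment> \<open>The only candidate roots. For \<open>t < c\<close> there is no root, and
    excluding these two points does no harm.\<close>
  have "AE y in lborel. y \<noteq> sqrt (t - c) - m" "AE y in lborel. y \<noteq> - sqrt (t - c) - m"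
    by (rule AE_lborel_singleton)+
  then have "AE y in lborel. c + (m + y)\<^sup>2 \<noteq> t"
  proof eventually_elim
    case (elim y)
    show ?case
    proof
      assume "c + (m + y)\<^sup>2 = t"
      then have "(m + y)\<^sup>2 = t - c" by simp
      then have "\<bar>m + y\<bar> = sqrt (t - c)"
        by (metis real_sqrt_abs)
      with elim show False by linarith
    qed
  qed
  then show ?thesis
    by (auto simp: AE_density elim: eventually_mono)
qed

text \<open>With all coordinates but the last frozen, at most two values of the last one give the
  sum \<open>t\<close>; Fubini then yields a null set. For \<open>d = 0\<close> the law is the point
  mass at 0, hence \<open>d > 0\<close>.\<close>

lemma AE_sq_norm_law_neq:
  assumes "d > 0"
  shows "AE u in sq_norm_law d \<mu>. u \<noteq> t"
proof -
  define N where "N = density lborel (\<lambda>x. ennreal (std_normal_density x))"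
  interpret N: prob_space N
    unfolding N_def by (rule prob_space_std_normal)
  interpret product_sigma_finite "\<lambda>_::nat. N"
    by standard
  have std: "std_gaussian d = (\<Pi>\<^sub>M i\<in>{..<d}. N)" for d
    by (simp add: std_gaussian_def N_def)
  obtain k where d: "d = Suc k"
    using assms gr0_implies_Suc by blast
  let ?u = "\<lambda>z. \<Sum>i<d. (\<mu> i + z i)\<^sup>2"
  have [measurable]: "?u \<in> borel_measurable (std_gaussian d)"
    using measurable_sq_norm_std_gaussian[of "\<lambda>i. i" d d] by simp
  have "(\<integral>\<^sup>+z. indicator {t} (?u z) \<partial>std_gaussian d) =
      (\<integral>\<^sup>+x. (\<integral>\<^sup>+y. indicator {t} (?u (x(k := y))) \<partial>N) \<partial>Pi\<^sub>M {..<k} (\<lambda>_. N))"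
  proof -
    have "(\<lambda>z. indicator {t} (?u z) :: ennreal) \<in> borel_measurable (Pi\<^sub>M (insert k {..<k}) (\<lambda>_. N))"
      unfolding std[symmetric] lessThan_Suc[symmetric] d[symmetric] by measurable
    from product_nn_integral_insert[OF _ _ this] show ?thesis
      unfolding std by (simp add: d lessThan_Suc)
  qed
  also have "\<dots> = (\<integral>\<^sup>+x. 0 \<partial>Pi\<^sub>M {..<k} (\<lambda>_. N))"
  proof (rule nn_integral_cong)
    fix x :: "nat \<Rightarrow> real"
    have eq: "?u (x(k := y)) = (\<Sum>i<k. (\<mu> i + x i)\<^sup>2) + (\<mu> k + y)\<^sup>2" for y
      by (simp add: d)
    have "AE y in N. ?u (x(k := y)) \<noteq> t"
      unfolding eq N_def by (rule AE_std_normal_square_neq)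
    then have "AE y in N. indicator {t} (?u (x(k := y))) = (0 :: ennreal)"
      by eventually_elim simp
    then have "(\<integral>\<^sup>+y. indicator {t} (?u (x(k := y))) \<partial>N) = (\<integral>\<^sup>+y. 0 \<partial>N)"
      by (rule nn_integral_cong_AE)
    then show "(\<integral>\<^sup>+y. indicator {t} (?u (x(k := y))) \<partial>N) = 0"
      by simp
  qed
  finally have "(\<integral>\<^sup>+z. indicator {t} (?u z) \<partial>std_gaussian d) = 0"
    by simp
  then have "AE z in std_gaussian d. indicator {t} (?u z) = (0 :: ennreal)"
    by (subst (asm) nn_integral_0_iff_AE) auto
  then have "AE z in std_gaussian d. ?u z \<noteq> t"
    by eventually_elim (auto simp: indicator_def split: if_splits)
  then show ?thesis
    unfolding sq_norm_law_def by (subst AE_distr_iff) auto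
qed

lemma AE_sq_norm_law_nonneg: "AE u in sq_norm_law d \<mu>. 0 \<le> u"
  using measurable_sq_norm_std_gaussian[of "\<lambda>i. i" d d \<mu>]
  unfolding sq_norm_law_def by (subst AE_distr_iff) (auto intro!: AE_I2 sum_nonneg)

section \<open>Orthonormal coordinates adapted to a projection\<close>

text \<open>Take any orthonormal basis \<open>b\<close> of \<open>W\<close> and let \<open>y\<close>
  be the vector with coordinates \<mu> in it. As \<open>x\<close> and \<open>y\<close> have equal
  norm, some isometry \<open>H\<close> preserving \<open>W\<close> maps \<open>y\<close> to
  \<open>x\<close>, and the basis \<open>H (b i)\<close> sees \<open>x\<close> exactly as
  \<open>b\<close> sees \<open>y\<close>.\<close>

lemma orthonormal_basis_prescribed_coords:
  fixes W :: "'a::euclidean_space set"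
  assumes W: "subspace W" and x: "x \<in> W" and \<mu>: "(\<Sum>i<dim W. (\<mu> i)\<^sup>2) = (norm x)\<^sup>2"
  obtains q :: "nat \<Rightarrow> 'a" where "\<And>i. i < dim W \<Longrightarrow> q i \<in> W"
    and "\<And>i j. i < dim W \<Longrightarrow> j < dim W \<Longrightarrow> q i \<bullet> q j = (if i = j then 1 else 0)"
    and "\<And>i. i < dim W \<Longrightarrow> q i \<bullet> x = \<mu> i"
proof -
  obtain B where B: "B \<subseteq> W" "pairwise orthogonal B" "\<And>v. v \<in> B \<Longrightarrow> norm v = 1"
    "independent B" "card B = dim W" "span B = W"
    using orthonormal_basis_subspace[OF W] by metis
  obtain b where b: "bij_betw b {..<dim W} B"
    using ex_bij_betw_nat_finite[of B] B by (auto simp: independent_imp_finite lessThan_atLeast0)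
  have bW: "b i \<in> W" if "i < dim W" for i
    using b B that by (auto simp: bij_betw_def)
  have bb: "b i \<bullet> b j = (if i = j then 1 else 0)" if "i < dim W" "j < dim W" for i j
  proof -
    have "b i \<in> B" "b j \<in> B" "b i = b j \<longleftrightarrow> i = j"
      using b that by (auto simp: bij_betw_def inj_on_def)
    then show ?thesis
      using B(2,3) by (auto simp: pairwise_def orthogonal_def norm_eq_1)
  qed
  define y where "y = (\<Sum>i<dim W. \<mu> i *\<^sub>R b i)"
  have by_eq: "b i \<bullet> y = \<mu> i" if "i < dim W" for i
    using that by (simp add: y_def inner_sum_right bb if_distrib[of "\<lambda>t. _ * t"] cong: if_cong)
  have "y \<bullet> y = (\<Sum>i<dim W. \<mu> i * (b i \<bullet> y))"
    by (subst y_def) (simp add: inner_sum_left)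
  also have "\<dots> = x \<bullet> x"
    using \<mu> by (simp add: by_eq power2_eq_square[symmetric] power2_norm_eq_inner)
  finally have yy: "y \<bullet> y = x \<bullet> x" .
  have yW: "y \<in> W"
    unfolding y_def using W bW by (intro subspace_sum subspace_scale) auto
  \<comment> \<open>The Householder reflection exchanging \<open>x\<close> and \<open>y\<close>; it is the identity when \<open>x = y\<close>, since \<open>1 / 0 = 0\<close>.\<close>
  define e where "e = y - x"
  define H where "H z = z - (2 * (e \<bullet> z) / (e \<bullet> e)) *\<^sub>R e" for z
  have HH: "H u \<bullet> H v = u \<bullet> v" for u v
    by (cases "e = 0") (simp_all add: H_def inner_diff_left inner_diff_right inner_commute field_simps)
  have Hy: "H y = x"
  proof (cases "e = 0")
    case False
    \<comment> \<open>This uses the equal norms; it makes the coefficient in \<open>H y\<close>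
      equal to 1, so that \<open>H y = y - e\<close>.\<close>
    have "2 * (e \<bullet> y) = e \<bullet> e"
      unfolding e_def using yy by (simp add: inner_diff_left inner_diff_right inner_commute)
    then show ?thesis
      using False by (simp add: H_def) (simp add: e_def)
  qed (simp add: H_def, simp add: e_def)
  show ?thesis
  proof
    show "H (b i) \<in> W" if "i < dim W" for i
      unfolding H_def e_def using W x yW bW[OF that] by (intro subspace_diff subspace_scale)
    show "H (b i) \<bullet> H (b j) = (if i = j then 1 else 0)" if "i < dim W" "j < dim W" for i j
      using that by (simp add: HH bb)
    show "H (b i) \<bullet> x = \<mu> i" if "i < dim W" for i
      using that by (simp add: Hy[symmetric] HH by_eq)
  qed
qed

section \<open>Projections onto the column space and its complement\<close>

lemma transpose_mult_vec_nth: "(transpose Q *v y) $ j = column j Q \<bullet> (y :: real ^ 'm)"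
  by (simp add: matrix_vector_mult_def transpose_def column_def inner_vec_def)

lemma orthonormal_columns_iff: "orthonormal_columns Q \<longleftrightarrow> transpose Q ** Q = mat 1"
  by (auto simp: orthonormal_columns_def vec_eq_iff matrix_matrix_mult_def transpose_def column_def
      inner_vec_def mat_def)

lemma proj_perp_diff: "proj_perp Q *v u = u - proj Q *v u"
  by (simp add: proj_perp_def proj_def matrix_vector_mult_diff_rdistrib)

text \<open>Orthonormal columns make \<open>Q\<close> an isometry, so the projection of
  \<open>u\<close> has the norm of its coefficient vector \<open>transpose Q *v u\<close>; the
  second part is Pythagoras.\<close>

lemma norm_proj:
  fixes Q :: "real ^ 'n ^ 'm"
  assumes "orthonormal_columns Q"
  shows "(norm (proj Q *v u))\<^sup>2 = (\<Sum>j\<in>UNIV. (column j Q \<bullet> u)\<^sup>2)"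
    and "(norm (proj_perp Q *v u))\<^sup>2 = (norm u)\<^sup>2 - (\<Sum>j\<in>UNIV. (column j Q \<bullet> u)\<^sup>2)"
proof -
  define c where "c = transpose Q *v u"
  have adj: "x \<bullet> (Q *v z) = (transpose Q *v x) \<bullet> z" for x z
    by (simp add: dot_lmul_matrix transpose_matrix_vector)
  have P: "proj Q *v u = Q *v c"
    by (simp add: c_def proj_def matrix_vector_mul_assoc del: transpose_matrix_vector)
  have "transpose Q *v (Q *v c) = c"
    using assms by (simp add: matrix_vector_mul_assoc orthonormal_columns_iff del: transpose_matrix_vector)
  then have Qc: "(Q *v c) \<bullet> (Q *v c) = c \<bullet> c"
    by (simp only: adj)
  have uQc: "u \<bullet> (Q *v c) = c \<bullet> c"
    by (simp only: adj c_def)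
  have cc: "c \<bullet> c = (\<Sum>j\<in>UNIV. (column j Q \<bullet> u)\<^sup>2)"
  proof -
    have "c $ j = column j Q \<bullet> u" for j
      by (simp only: c_def transpose_mult_vec_nth)
    then show ?thesis
      by (simp add: inner_vec_def[of c] power2_eq_square)
  qed
  show "(norm (proj Q *v u))\<^sup>2 = (\<Sum>j\<in>UNIV. (column j Q \<bullet> u)\<^sup>2)"
    by (simp add: power2_norm_eq_inner P Qc cc)
  show "(norm (proj_perp Q *v u))\<^sup>2 = (norm u)\<^sup>2 - (\<Sum>j\<in>UNIV. (column j Q \<bullet> u)\<^sup>2)"
    by (simp add: power2_norm_eq_inner proj_perp_diff P inner_diff_left inner_diff_right Qc uQc cc
        inner_commute[of "Q *v c" u])
qed

lemma dim_orthogonal_columns: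
  fixes Q :: "real ^ 'n ^ 'm"
  assumes "orthonormal_columns Q"
  shows "dim {y. \<forall>j. column j Q \<bullet> y = 0} = CARD('m) - CARD('n)"
proof -
  have Q: "column i Q \<bullet> column j Q = (if i = j then 1 else 0)" for i j
    using assms by (auto simp: orthonormal_columns_def)
  let ?C = "range (\<lambda>j. column j Q)"
  have "inj (\<lambda>j. column j Q)"
  proof (rule injI)
    fix i j assume "column i Q = column j Q"
    with Q[of i j] Q[of j j] show "i = j"
      by (simp split: if_splits)
  qed
  then have card: "card ?C = CARD('n)"
    by (simp add: card_image)
  have "0 \<notin> ?C"
  proof
    assume "0 \<in> ?C"
    then obtain j where "column j Q = 0"
      by auto
    with Q[of j j] show False
      by simp
  qed
  then have "independent ?C"
    by (intro pairwise_orthogonal_independent) (auto simp: pairwise_def orthogonal_def Q)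
  then have dimC: "dim (span ?C) = CARD('n)"
    by (simp add: dim_eq_card_independent card)
  have "{y. \<forall>j. column j Q \<bullet> y = 0} = {y \<in> UNIV. \<forall>x \<in> span ?C. orthogonal x y}"
  proof (intro set_eqI iffI)
    fix y assume "y \<in> {y. \<forall>j. column j Q \<bullet> y = 0}"
    then show "y \<in> {y \<in> UNIV. \<forall>x \<in> span ?C. orthogonal x y}"
    proof clarsimp
      fix x assume "x \<in> span ?C"
      then have "orthogonal y x"
        by (rule orthogonal_to_span)
           (use \<open>y \<in> {y. \<forall>j. column j Q \<bullet> y = 0}\<close> in \<open>auto simp: orthogonal_def inner_commute\<close>)
      then show "orthogonal x y"
        by (simp add: orthogonal_commute)
    qed
  qed (auto simp: orthogonal_def span_base)
  then show ?thesis
    using dim_subspace_orthogonal_to_vectors[of "span ?C" UNIV] dimC by simp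
qed

lemma sum_lessThan_add: "(\<Sum>i<a + b. f i) = (\<Sum>i<a. f i) + (\<Sum>i<b. f (a + i))"
  for f :: "nat \<Rightarrow> 'a::comm_monoid_add"
  by (induction b) (simp_all add: add.assoc)

text \<open>The rows of the matrix are a basis of the complement in which \<open>X\<close> has
  coordinates \<mu>, followed by the columns of \<open>Q\<close>. The first block of coordinates
  then measures \<open>proj_perp Q\<close>, the second \<open>proj Q\<close>.\<close>

lemma adapted_orthogonal_transformation:
  fixes Q :: "real ^ 'n ^ 'm" and h :: "nat \<Rightarrow> 'm"
  defines "d \<equiv> CARD('m) - CARD('n)"
  assumes Q: "orthonormal_columns Q" and nm: "CARD('n) < CARD('m)"
    and h: "bij_betw h {..<CARD('m)} UNIV"
    and X: "X \<in> range (\<lambda>v. proj_perp Q *v v)" and \<mu>: "(\<Sum>i<d. (\<mu> i)\<^sup>2) = (norm X)\<^sup>2"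
  obtains T :: "real ^ 'm \<Rightarrow> real ^ 'm" where "orthogonal_transformation T"
    and "\<And>y. (norm (proj_perp Q *v (X + y)))\<^sup>2 = (\<Sum>i<d. (\<mu> i + T y $ h i)\<^sup>2)"
    and "\<And>y. (norm (proj Q *v y))\<^sup>2 = (\<Sum>i<CARD('n). (T y $ h (d + i))\<^sup>2)"
proof -
  let ?m = "CARD('m)" and ?n = "CARD('n)"
  have m: "?m = d + ?n"
    using nm by (simp add: d_def)
  define W where "W = {y. \<forall>j. column j Q \<bullet> y = 0}"
  have W: "subspace W"
    by (auto simp: W_def subspace_def inner_add_right)
  have dim: "dim W = d"
    unfolding W_def d_def by (rule dim_orthogonal_columns[OF Q])
  obtain v where v: "X = proj_perp Q *v v"
    using X by auto
  \<comment> \<open>Since \<open>transpose Q ** Q\<close> is the identity, the two terms cancel and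
    \<open>X\<close> is orthogonal to every column.\<close>
  have "transpose Q *v X = transpose Q *v v - (transpose Q ** Q) *v (transpose Q *v v)"
    by (simp add: v proj_perp_diff proj_def matrix_vector_mult_diff_distrib matrix_vector_mul_assoc matrix_mul_assoc
        del: transpose_matrix_vector)
  then have "transpose Q *v X = 0"
    using Q by (simp add: orthonormal_columns_iff)
  then have QX: "column j Q \<bullet> X = 0" for j
    by (metis transpose_mult_vec_nth zero_index)
  then have XW: "X \<in> W"
    by (simp add: W_def)
  obtain q where q: "\<And>i. i < d \<Longrightarrow> q i \<in> W"
    "\<And>i j. i < d \<Longrightarrow> j < d \<Longrightarrow> q i \<bullet> q j = (if i = j then 1 else 0)"
    "\<And>i. i < d \<Longrightarrow> q i \<bullet> X = \<mu> i"
    using orthonormal_basis_prescribed_coords[OF W XW, of \<mu>] \<mu> unfolding dim by metis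
  obtain c :: "nat \<Rightarrow> 'n" where c: "bij_betw c {..<?n} UNIV"
    using ex_bij_betw_nat_finite[of "UNIV :: 'n set"] by (auto simp: lessThan_atLeast0)
  define p where "p i = (if i < d then q i else column (c (i - d)) Q)" for i
  have p1: "p i = q i" if "i < d" for i
    using that by (simp add: p_def)
  have p2: "p (d + i) = column (c i) Q" for i
    by (simp add: p_def)
  have cc: "c i = c j \<longleftrightarrow> i = j" if "i < ?n" "j < ?n" for i j
    using c that by (auto simp: bij_betw_def inj_on_def)
  have pp: "p i \<bullet> p j = (if i = j then 1 else 0)" if "i < ?m" "j < ?m" for i j
  proof -
    have "q k \<bullet> column l Q = 0" "column l Q \<bullet> q k = 0" if "k < d" for k l
      using q(1)[OF that] by (auto simp: W_def inner_commute)
    moreover have "column (c (i - d)) Q \<bullet> column (c (j - d)) Q = (if i = j then 1 else 0)"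
      if "d \<le> i" "d \<le> j"
      using Q that cc[of "i - d" "j - d"] \<open>i < ?m\<close> \<open>j < ?m\<close> m
      by (auto simp: orthonormal_columns_def)
    ultimately show ?thesis
      by (auto simp: p_def q)
  qed
  define g where "g = the_inv_into {..<?m} h"
  have gh: "g (h i) = i" if "i < ?m" for i
    using h that unfolding g_def bij_betw_def by (intro the_inv_into_f_f) auto
  have hg: "h (g k) = k" for k
    using h unfolding g_def bij_betw_def by (intro f_the_inv_into_f) auto
  have gm: "g k < ?m" for k
    using bij_betw_the_inv_into[OF h] unfolding g_def by (auto simp: bij_betw_def)
  \<comment> \<open>Rows are indexed by the type \<open>'m\<close>, so the numbering is undone by
    \<open>g\<close>, the inverse of \<open>h\<close>.\<close>
  define A :: "real ^ 'm ^ 'm" where "A = (\<chi> k. p (g k))"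
  have row: "row k A = p (g k)" for k
    by (simp add: A_def row_def)
  have "orthogonal_matrix A"
    unfolding orthogonal_matrix_orthonormal_rows
  proof (intro conjI allI impI)
    fix k l :: 'm
    show "norm (row k A) = 1"
      by (simp add: row norm_eq_1 pp gm)
    assume "k \<noteq> l"
    then have "g k \<noteq> g l"
      by (metis hg)
    then show "orthogonal (row k A) (row l A)"
      by (simp add: row orthogonal_def pp gm)
  qed
  then have T: "orthogonal_transformation ((*v) A)"
    by (simp add: orthogonal_transformation_matrix)
  have nth: "(A *v y) $ h i = p i \<bullet> y" if "i < ?m" for i y
    using gh[OF that] by (simp add: matrix_vector_mul_component A_def)
  have cols: "(\<Sum>j\<in>UNIV. (column j Q \<bullet> y)\<^sup>2) = (\<Sum>i<?n. (p (d + i) \<bullet> y)\<^sup>2)" for y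
    unfolding p2 by (rule sum.reindex_bij_betw[OF c, symmetric])
  have norm: "(norm u)\<^sup>2 = (\<Sum>i<d. (p i \<bullet> u)\<^sup>2) + (\<Sum>i<?n. (p (d + i) \<bullet> u)\<^sup>2)" for u
  proof -
    have "(norm u)\<^sup>2 = (norm (A *v u))\<^sup>2"
      using orthogonal_transformation_norm[OF T] by simp
    also have "\<dots> = (\<Sum>k\<in>UNIV. ((A *v u) $ k)\<^sup>2)"
      by (simp add: norm_vec_def L2_set_def sum_nonneg)
    also have "\<dots> = (\<Sum>i<?m. ((A *v u) $ h i)\<^sup>2)"
      by (rule sum.reindex_bij_betw[OF h, symmetric])
    also have "\<dots> = (\<Sum>i<?m. (p i \<bullet> u)\<^sup>2)"
      by (simp add: nth)
    also have "\<dots> = (\<Sum>i<d. (p i \<bullet> u)\<^sup>2) + (\<Sum>i<?n. (p (d + i) \<bullet> u)\<^sup>2)"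
      unfolding m by (rule sum_lessThan_add)
    finally show ?thesis .
  qed
  show ?thesis
  proof (rule that[OF T])
    fix y
    \<comment> \<open>Removing the column part from the full norm leaves exactly the first
      \<open>d\<close> squares.\<close>
    have "(norm (proj_perp Q *v (X + y)))\<^sup>2 = (\<Sum>i<d. (p i \<bullet> (X + y))\<^sup>2)"
      by (simp add: norm_proj(2)[OF Q] norm[of "X + y"] cols)
    also have "\<dots> = (\<Sum>i<d. (\<mu> i + (A *v y) $ h i)\<^sup>2)"
      using m by (intro sum.cong) (auto simp: nth inner_add_right p1 q(3))
    finally show "(norm (proj_perp Q *v (X + y)))\<^sup>2 = (\<Sum>i<d. (\<mu> i + (A *v y) $ h i)\<^sup>2)" .
    show "(norm (proj Q *v y))\<^sup>2 = (\<Sum>i<?n. ((A *v y) $ h (d + i))\<^sup>2)"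
      by (simp add: norm_proj[OF Q] cols nth m)
  qed
qed

section \<open>The law of the normalized residual\<close>

text \<open>Both sides compare \<open>u * (1 - \<tau>\<^sup>2)\<close> with
  \<open>\<tau>\<^sup>2 * v\<close> after squaring and clearing denominators; the degrees of freedom
  only scale both sides by \<open>b / a\<close>. The assumption \<open>ne\<close> excludes equality,
  which lets a weak inequality become the negation of the reverse weak one, as a CDF
  requires.\<close>

lemma normalized_sqrt_ge_iff_ratio:
  fixes u v \<tau> a b :: real
  assumes u: "u \<ge> 0" and v: "v > 0" and \<tau>: "0 < \<tau>" "\<tau> < 1" and ab: "a > 0" "b > 0"
    and ne: "v \<noteq> u * (1 - \<tau>\<^sup>2) / \<tau>\<^sup>2"
  shows "\<tau> \<le> sqrt (u / (u + v)) \<longleftrightarrow> \<not> (u / a) / (v / b) \<le> b * \<tau>\<^sup>2 / (a * (1 - \<tau>\<^sup>2))"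
proof -
  have \<tau>2: "0 < \<tau>\<^sup>2" "0 < 1 - \<tau>\<^sup>2"
    using \<tau> by (auto simp: power_less_one_iff abs_square_less_1)
  have "\<tau> \<le> sqrt (u / (u + v)) \<longleftrightarrow> \<tau>\<^sup>2 \<le> u / (u + v)"
    using \<tau> by (metis less_eq_real_def real_le_rsqrt real_sqrt_le_iff real_sqrt_unique)
  also have "\<dots> \<longleftrightarrow> \<tau>\<^sup>2 * v \<le> u * (1 - \<tau>\<^sup>2)"
    using u v by (simp add: pos_le_divide_eq algebra_simps)
  also have "\<dots> \<longleftrightarrow> \<not> u * (1 - \<tau>\<^sup>2) \<le> \<tau>\<^sup>2 * v"
    using ne \<tau>2 by (auto simp: field_simps)
  also have "u * (1 - \<tau>\<^sup>2) \<le> \<tau>\<^sup>2 * v \<longleftrightarrow> (u / a) / (v / b) \<le> b * \<tau>\<^sup>2 / (a * (1 - \<tau>\<^sup>2))"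
  proof -
    have "(u / a) / (v / b) = (b / a) * (u / v)" "b * \<tau>\<^sup>2 / (a * (1 - \<tau>\<^sup>2)) = (b / a) * (\<tau>\<^sup>2 / (1 - \<tau>\<^sup>2))"
      by simp_all
    then have "(u / a) / (v / b) \<le> b * \<tau>\<^sup>2 / (a * (1 - \<tau>\<^sup>2)) \<longleftrightarrow> u / v \<le> \<tau>\<^sup>2 / (1 - \<tau>\<^sup>2)"
      using ab by (simp only: mult_le_cancel_left_pos zero_less_divide_iff simp_thms)
    also have "\<dots> \<longleftrightarrow> u * (1 - \<tau>\<^sup>2) \<le> \<tau>\<^sup>2 * v"
      using v \<tau>2 by (simp add: divide_le_eq pos_le_divide_eq mult.commute)
    finally show ?thesis by simp
  qed
  finally show ?thesis .
qed

lemma noncentral_chi_square_eq: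
  assumes "d > 0" "\<delta> \<ge> 0"
  obtains \<mu> where "(\<Sum>i<d. (\<mu> i)\<^sup>2) = \<delta>" "noncentral_chi_square d \<delta> = sq_norm_law d \<mu>"
proof -
  \<comment> \<open>A witness, available since \<open>d > 0\<close>, guarantees that the chosen
    vector has the required squared norm.\<close>
  have "(\<Sum>i<d. (if i = 0 then sqrt \<delta> else 0)\<^sup>2) = \<delta>"
    using assms by (simp add: if_distrib[of "\<lambda>t. t\<^sup>2"] sum.delta cong: if_cong)
  then have "(\<Sum>i<d. ((SOME \<mu>. (\<Sum>i<d. (\<mu> i)\<^sup>2) = \<delta>) i)\<^sup>2) = \<delta>"
    by (rule someI[of "\<lambda>\<mu>. (\<Sum>i<d. (\<mu> i)\<^sup>2) = \<delta>"])
  then show ?thesis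
    using that by (simp add: noncentral_chi_square_def)
qed

lemma measure_sq_norm_laws_noncentral_F:
  fixes \<tau> :: real
  assumes d: "d > 0" "n > 0" and \<tau>: "0 < \<tau>" "\<tau> < 1"
    and \<mu>: "noncentral_chi_square d \<delta> = sq_norm_law d \<mu>"
  shows "measure (sq_norm_law d \<mu> \<Otimes>\<^sub>M chi_square n) {(u, v). \<tau> \<le> sqrt (u / (u + v))} =
    1 - cdf (noncentral_F d n \<delta>) (real n * \<tau>\<^sup>2 / (real d * (1 - \<tau>\<^sup>2)))"
proof -
  define N1 where "N1 = sq_norm_law d \<mu>"
  define N2 where "N2 = chi_square n"
  have N2: "N2 = sq_norm_law n (\<lambda>_. 0)"
    by (simp add: N2_def chi_square_def)
  interpret N1: prob_space N1
    unfolding N1_def by (rule prob_space_sq_norm_law)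
  interpret N2: prob_space N2
    unfolding N2 by (rule prob_space_sq_norm_law)
  interpret pair_prob_space N1 N2 ..
  have [simp, measurable_cong]: "sets N1 = sets borel" "sets N2 = sets borel"
    by (simp_all add: N1_def N2)
  then have [simp]: "space N1 = UNIV" "space N2 = UNIV"
    by (metis sets_eq_imp_space_eq space_borel)+
  define c where "c = real n * \<tau>\<^sup>2 / (real d * (1 - \<tau>\<^sup>2))"
  let ?f = "\<lambda>(u, v). (u / real d) / (v / real n)"
  let ?A = "{p \<in> space (N1 \<Otimes>\<^sub>M N2). ?f p \<le> c}"
  let ?E = "{(u, v). \<tau> \<le> sqrt (u / (u + v))}"
  have [measurable]: "?f \<in> borel_measurable (N1 \<Otimes>\<^sub>M N2)"
    by measurable
  have A: "?A \<in> sets (N1 \<Otimes>\<^sub>M N2)"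
    by measurable
  have sp: "space (N1 \<Otimes>\<^sub>M N2) = UNIV"
    by (simp add: space_pair_measure)
  have "{p \<in> space (N1 \<Otimes>\<^sub>M N2). \<tau> \<le> sqrt (fst p / (fst p + snd p))} \<in> sets (N1 \<Otimes>\<^sub>M N2)"
    by measurable
  then have E: "?E \<in> sets (N1 \<Otimes>\<^sub>M N2)"
    by (simp add: sp case_prod_unfold)
  \<comment> \<open>For fixed \<open>u\<close> the second component must avoid just 0 and the
    boundary value of the event, both null for an atomless law. Off this null set the event is the
    complement of \<open>?A\<close>.\<close>
  have ae: "AE p in N1 \<Otimes>\<^sub>M N2. 0 \<le> fst p \<and> 0 < snd p \<and> snd p \<noteq> fst p * (1 - \<tau>\<^sup>2) / \<tau>\<^sup>2"
  proof (rule AE_pair_measure)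
    show "{p \<in> space (N1 \<Otimes>\<^sub>M N2). 0 \<le> fst p \<and> 0 < snd p \<and> snd p \<noteq> fst p * (1 - \<tau>\<^sup>2) / \<tau>\<^sup>2} \<in> sets (N1 \<Otimes>\<^sub>M N2)"
      by measurable
    have "AE u in N1. 0 \<le> u"
      unfolding N1_def by (rule AE_sq_norm_law_nonneg)
    then show "AE u in N1. AE v in N2. 0 \<le> fst (u, v) \<and> 0 < snd (u, v) \<and>
        snd (u, v) \<noteq> fst (u, v) * (1 - \<tau>\<^sup>2) / \<tau>\<^sup>2"
    proof eventually_elim
      case (elim u)
      have "AE v in N2. 0 \<le> v" "AE v in N2. v \<noteq> 0" "AE v in N2. v \<noteq> u * (1 - \<tau>\<^sup>2) / \<tau>\<^sup>2"
        unfolding N2 by (rule AE_sq_norm_law_nonneg AE_sq_norm_law_neq d)+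
      then show ?case
        by eventually_elim (use elim in auto)
    qed
  qed
  have "measure (N1 \<Otimes>\<^sub>M N2) ?E = measure (N1 \<Otimes>\<^sub>M N2) (space (N1 \<Otimes>\<^sub>M N2) - ?A)"
  proof (rule finite_measure_eq_AE)
    show "AE p in N1 \<Otimes>\<^sub>M N2. (p \<in> ?E) = (p \<in> space (N1 \<Otimes>\<^sub>M N2) - ?A)"
      using ae
    proof eventually_elim
      case (elim p)
      then show ?case
        using normalized_sqrt_ge_iff_ratio[of "fst p" "snd p" \<tau> "real d" "real n"] d \<tau>
        by (auto simp: sp c_def case_prod_unfold)
    qed
  qed (intro E sets.compl_sets[OF A])+
  also have "\<dots> = 1 - measure (N1 \<Otimes>\<^sub>M N2) ?A"
    by (rule prob_compl[OF A])
  also have "measure (N1 \<Otimes>\<^sub>M N2) ?A = cdf (noncentral_F d n \<delta>) c"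
    unfolding noncentral_F_def \<mu> cdf_def N1_def[symmetric] N2_def[symmetric]
    by (subst measure_distr) (auto intro!: arg_cong[where f="measure _"])
  finally show ?thesis
    by (simp add: N1_def N2_def c_def)
qed

theorem theorem6p1:
  fixes Q :: "real ^ 'n ^ 'm" and X :: "real ^ 'm" and \<sigma> \<tau> :: real
    and M :: "'a measure" and Y :: "'a \<Rightarrow> real ^ 'm"
  assumes "prob_space M"
    and "CARD('n) < CARD('m)"
    and "orthonormal_columns Q"
    and "X \<in> range (\<lambda>v. proj_perp Q *v v)"
    and "\<sigma> > 0"
    and "distributed M lborel Y (\<lambda>y. ennreal (gaussian_density 0 (mat (\<sigma>\<^sup>2)) y))"
    and "0 < \<tau>" and "\<tau> < 1"
  shows "measure M {\<omega> \<in> space M. norm (r_hat Q X (Y \<omega>)) \<ge> \<tau>} =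
    1 - cdf (noncentral_F (CARD('m) - CARD('n)) (CARD('n)) ((norm X)\<^sup>2 / \<sigma>\<^sup>2))
          (real CARD('n) * \<tau>\<^sup>2 / (real (CARD('m) - CARD('n)) * (1 - \<tau>\<^sup>2)))"
proof -
  define d where "d = CARD('m) - CARD('n)"
  define n where "n = CARD('n)"
  define \<delta> where "\<delta> = (norm X)\<^sup>2 / \<sigma>\<^sup>2"
  have dn: "d > 0" "n > 0" and m: "CARD('m) = d + n"
    using assms(2) by (auto simp: d_def n_def)
  have [simp]: "\<sigma> \<noteq> 0"
    using assms(5) by simp
  obtain \<mu> where \<mu>: "(\<Sum>i<d. (\<mu> i)\<^sup>2) = \<delta>" "noncentral_chi_square d \<delta> = sq_norm_law d \<mu>"
    using noncentral_chi_square_eq[OF dn(1), of \<delta>] by (auto simp: \<delta>_def)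
  obtain h :: "nat \<Rightarrow> 'm" where h: "bij_betw h {..<CARD('m)} UNIV"
    using ex_bij_betw_nat_finite[of "UNIV :: 'm set"] by (auto simp: lessThan_atLeast0)
  have X: "X /\<^sub>R \<sigma> \<in> range (\<lambda>v. proj_perp Q *v v)"
    using assms(4) by (auto simp: matrix_vector_mult_scaleR[symmetric])
  \<comment> \<open>The vector \<mu> chosen inside the noncentral chi-square law serves as the
    coordinates of the rescaled \<open>X\<close>.\<close>
  have \<mu>X: "(\<Sum>i<CARD('m) - CARD('n). (\<mu> i)\<^sup>2) = (norm (X /\<^sub>R \<sigma>))\<^sup>2"
    using \<mu>(1) by (simp add: d_def \<delta>_def power_mult_distrib power_inverse divide_inverse mult.commute)
  obtain T :: "real ^ 'm \<Rightarrow> real ^ 'm" where T: "orthogonal_transformation T"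
    and perp: "\<And>y. (norm (proj_perp Q *v (X /\<^sub>R \<sigma> + y)))\<^sup>2 = (\<Sum>i<d. (\<mu> i + T y $ h i)\<^sup>2)"
    and par: "\<And>y. (norm (proj Q *v y))\<^sup>2 = (\<Sum>i<n. (T y $ h (d + i))\<^sup>2)"
    by (rule adapted_orthogonal_transformation[OF assms(3,2) h X \<mu>X, folded d_def n_def]) (rule that; assumption)
  \<comment> \<open>The summand 0 gives the second sum the shape of a \<open>sq_norm_law\<close>
    with zero mean, that is, of \<open>chi_square\<close>.\<close>
  define UV :: "(nat \<Rightarrow> real) \<Rightarrow> real \<times> real"
    where "UV z = (\<Sum>i<d. (\<mu> i + z i)\<^sup>2, \<Sum>i<n. (0 + z (d + i))\<^sup>2)" for z
  define Z where "Z \<omega> = (\<lambda>i\<in>{..<d + n}. T (Y \<omega> /\<^sub>R \<sigma>) $ h i)" for \<omega>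
  define E :: "(real \<times> real) set" where "E = {(u, v). \<tau> \<le> sqrt (u / (u + v))}"
  \<comment> \<open>The common factor \<open>\<sigma>\<^sup>2\<close> cancels in the ratio. The
    equivalence holds at every \<omega>: where the denominator vanishes, both \<open>r_hat\<close>
    and \<open>u / (u + v)\<close> are 0.\<close>
  have event: "\<tau> \<le> norm (r_hat Q X (Y \<omega>)) \<longleftrightarrow> UV (Z \<omega>) \<in> E" for \<omega>
  proof -
    define u v where "u = fst (UV (Z \<omega>))" and "v = snd (UV (Z \<omega>))"
    have "X + Y \<omega> = \<sigma> *\<^sub>R (X /\<^sub>R \<sigma> + Y \<omega> /\<^sub>R \<sigma>)"
      by (simp add: scaleR_add_right)
    then have u: "(norm (proj_perp Q *v (X + Y \<omega>)))\<^sup>2 = \<sigma>\<^sup>2 * u"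
      using perp[of "Y \<omega> /\<^sub>R \<sigma>"]
      by (simp add: u_def UV_def Z_def matrix_vector_mult_scaleR power_mult_distrib del: scaleR_add_right)
    have v: "(norm (proj Q *v Y \<omega>))\<^sup>2 = \<sigma>\<^sup>2 * v"
    proof -
      have "v = (norm (proj Q *v (Y \<omega> /\<^sub>R \<sigma>)))\<^sup>2"
        by (simp only: par) (simp add: v_def UV_def Z_def)
      then show ?thesis
        by (simp add: matrix_vector_mult_scaleR power_mult_distrib power_inverse field_simps)
    qed
    have "0 \<le> u" "0 \<le> v"
      by (simp_all add: u_def v_def UV_def sum_nonneg)
    then have "norm (r_hat Q X (Y \<omega>)) = norm (proj_perp Q *v (X + Y \<omega>)) / sqrt (\<sigma>\<^sup>2 * u + \<sigma>\<^sup>2 * v)"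
      unfolding r_hat_def u v by (simp add: divide_inverse mult.commute)
    also have "norm (proj_perp Q *v (X + Y \<omega>)) = sqrt (\<sigma>\<^sup>2 * u)"
      by (simp add: u[symmetric])
    also have "sqrt (\<sigma>\<^sup>2 * u) / sqrt (\<sigma>\<^sup>2 * u + \<sigma>\<^sup>2 * v) = sqrt ((\<sigma>\<^sup>2 * u) / (\<sigma>\<^sup>2 * (u + v)))"
      by (simp only: real_sqrt_divide distrib_left)
    also have "\<dots> = sqrt (u / (u + v))"
      by simp
    finally show ?thesis
      by (simp add: E_def case_prod_unfold u_def v_def)
  qed
  have [measurable]: "Y \<in> M \<rightarrow>\<^sub>M borel"
    using distributed_measurable[OF assms(6)] by simp
  have [measurable]: "T \<in> borel_measurable borel"
    using T by (intro borel_measurable_continuous_onI linear_continuous_on linear_conv_bounded_linear[THEN iffD1]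
        orthogonal_transformation_linear)
  let ?B = "\<Pi>\<^sub>M i\<in>{..<d + n}. (borel :: real measure)"
  let ?W = "\<lambda>\<omega>. T (Y \<omega> /\<^sub>R \<sigma>)" and ?G = "\<lambda>y :: real ^ 'm. \<lambda>i\<in>{..<d + n}. y $ h i"
  have Wm: "?W \<in> M \<rightarrow>\<^sub>M borel"
    by measurable
  have Gm: "?G \<in> borel \<rightarrow>\<^sub>M ?B"
    by measurable
  have Z: "Z = ?G \<circ> ?W"
    by (simp add: Z_def fun_eq_iff)
  have Zm: "Z \<in> M \<rightarrow>\<^sub>M ?B"
    unfolding Z using Wm Gm by (rule measurable_comp)
  have UVm: "UV \<in> ?B \<rightarrow>\<^sub>M borel \<Otimes>\<^sub>M borel"
    unfolding UV_def by (intro measurable_Pair measurable_shifted_sq_sum) auto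
  have Em: "E \<in> sets (borel \<Otimes>\<^sub>M borel)"
  proof -
    have "{p \<in> space (borel \<Otimes>\<^sub>M borel). \<tau> \<le> sqrt (fst p / (fst p + snd p))} \<in> sets (borel \<Otimes>\<^sub>M (borel :: real measure))"
      by measurable
    then show ?thesis
      by (simp add: E_def case_prod_unfold space_pair_measure)
  qed
  \<comment> \<open>Law of the coordinates: rotate and rescale on \<open>real ^ 'm\<close> first,
    then pass to functions on \<open>{..<d + n}\<close>.\<close>
  have "distr M ?B Z = distr (distr M borel ?W) ?B ?G"
    unfolding Z using Gm Wm by (rule distr_distr[symmetric])
  also have "\<dots> = std_gaussian (d + n)"
    unfolding distr_orthogonal_gaussian[OF assms(5,6) T] using h m by (intro std_gaussian_eq_distr_vec) simp
  finally have law: "distr M ?B Z = std_gaussian (d + n)" .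
  have "distr M (borel \<Otimes>\<^sub>M borel) (UV \<circ> Z) = distr (distr M ?B Z) (borel \<Otimes>\<^sub>M borel) UV"
    using UVm Zm by (rule distr_distr[symmetric])
  also have "\<dots> = sq_norm_law d \<mu> \<Otimes>\<^sub>M chi_square n"
    unfolding law UV_def chi_square_def by (rule distr_std_gaussian_blocks)
  finally have joint: "distr M (borel \<Otimes>\<^sub>M borel) (UV \<circ> Z) = sq_norm_law d \<mu> \<Otimes>\<^sub>M chi_square n" .
  have "measure M {\<omega> \<in> space M. \<tau> \<le> norm (r_hat Q X (Y \<omega>))} = measure (distr M (borel \<Otimes>\<^sub>M borel) (UV \<circ> Z)) E"
    using measurable_comp[OF Zm UVm] Em
    by (subst measure_distr) (auto simp: event intro!: arg_cong[where f="measure M"])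
  also have "\<dots> = 1 - cdf (noncentral_F d n \<delta>) (real n * \<tau>\<^sup>2 / (real d * (1 - \<tau>\<^sup>2)))"
    unfolding joint E_def using dn assms(7,8) \<mu>(2) by (rule measure_sq_norm_laws_noncentral_F)
  finally show ?thesis
    by (simp add: d_def n_def \<delta>_def)
qed

end
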